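(* Let $\mathcal{X}$ be a Polish space and let $H_0$ versus $H_1$ be any hypothesis testing problem over $\mathcal{X}$. Let $\mathrm{int}(\cdot)$ denote interior in the ambient space $H_0\cup H_1$ (with the subspace topology inherited from the weak topology). Then the following are equivalent: (1) The two hypotheses $H_0$ and $H_1$ are nowhere intertwined. (2) $\mathrm{int}(H_0)\cup\mathrm{int}(H_1)$ is dense in $H_0\cup H_1$. (3) Each hypothesis $H_i$ ($i\in\{0,1\}$) is the union of an open set and a nowhere dense set (both taken in $H_0\cup H_1$). In particular, if $H_0$ and $H_1$ are nowhere intertwined, then each $H_i$ is either open in $H_0\cup H_1$, or nowhere dense in $H_0\cup H_1$, or the union of a nonempty open set with a nonempty nowhere dense set (both in $H_0\cup H_1$).
   Context: $\mathcal{X}$ is a Polish space with Borel $\sigma$-algebra $\mathscr{B}(\mathcal{X})$. The set of all probability measures on $\mathscr{B}(\mathcal{X})$ carries the weak topology (the topology of weak convergence of measures), and every subset of it carries the subspace topology. A hypothesis is a set of probability measures on $\mathscr{B}(\mathcal{X})$; a hypothesis testing problem consists of two disjoint hypotheses $H_0$ and $H_1$. The ambient topological space is $H_0\cup H_1$ with the subspace topology. $H_0$ and $H_1$ are intertwined in a nonempty open subset $O$ of $H_0\cup H_1$ iff both $H_0$ and $H_1$ are dense in $O$ (i.e. $H_0\cap O$ and $H_1\cap O$ are both dense in $O$). They are nowhere intertwined iff they are intertwined in no nonempty open subset of $H_0\cup H_1$. *)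

theory Defs
  imports "HOL-Probability.Probability"
begin

definition prob_measures :: "'a::topological_space measure set" where
  "prob_measures = {M. prob_space M \<and> sets M = sets borel}"

text \<open>The coarsest topology on the Borel probability measures for which
  \<open>M \<mapsto> \<integral>x. f x \<partial>M\<close> is continuous for every bounded continuous real function \<open>f\<close>;
  the generating sets are the preimages of open sets under these maps.
  The carrier itself is among them (take \<open>U = UNIV\<close>).\<close>

definition weak_topology :: "'a::topological_space measure topology" where
  "weak_topology = topology_generated_by
     {{M \<in> prob_measures. (\<integral>x. f x \<partial>M) \<in> U} | (f :: 'a \<Rightarrow> real) (U :: real set).
        continuous_on UNIV f \<and> bounded (range f) \<and> open U}"

lemma topspace_weak_topology: "topspace weak_topology = prob_measures"
proof
  show "topspace weak_topology \<subseteq> (prob_measures :: 'a measure set)"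
    unfolding weak_topology_def topology_generated_by_topspace by blast
  have "(prob_measures :: 'a measure set) \<in>
     {{M \<in> prob_measures. (\<integral>x. f x \<partial>M) \<in> U} | (f :: 'a \<Rightarrow> real) (U :: real set).
        continuous_on UNIV f \<and> bounded (range f) \<and> open U}"
    by (rule CollectI, rule exI[of _ "\<lambda>_. 0"], rule exI[of _ UNIV]) auto
  then show "(prob_measures :: 'a measure set) \<subseteq> topspace weak_topology"
    unfolding weak_topology_def topology_generated_by_topspace by (rule Union_upper)
qed

definition testing_problem ::
    "'a::topological_space measure set \<Rightarrow> 'a measure set \<Rightarrow> bool" where
  "testing_problem H0 H1 \<longleftrightarrow>
     H0 \<subseteq> prob_measures \<and> H1 \<subseteq> prob_measures \<and> H0 \<inter> H1 = {}"

definition ambient_space ::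
    "'a::topological_space measure set \<Rightarrow> 'a measure set \<Rightarrow> 'a measure topology" where
  "ambient_space H0 H1 = subtopology weak_topology (H0 \<union> H1)"

definition dense_in :: "'b topology \<Rightarrow> 'b set \<Rightarrow> bool" where
  "dense_in X S \<longleftrightarrow> S \<subseteq> topspace X \<and> X closure_of S = topspace X"

definition nowhere_dense_in :: "'b topology \<Rightarrow> 'b set \<Rightarrow> bool" where
  "nowhere_dense_in X S \<longleftrightarrow>
     S \<subseteq> topspace X \<and> X interior_of (X closure_of S) = {}"

definition intertwined_in ::
    "'a::topological_space measure set \<Rightarrow> 'a measure set \<Rightarrow> 'a measure set \<Rightarrow> bool" where
  "intertwined_in H0 H1 V \<longleftrightarrow>
     dense_in (subtopology (ambient_space H0 H1) V) (H0 \<inter> V) \<and>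
     dense_in (subtopology (ambient_space H0 H1) V) (H1 \<inter> V)"

definition nowhere_intertwined ::
    "'a::topological_space measure set \<Rightarrow> 'a measure set \<Rightarrow> bool" where
  "nowhere_intertwined H0 H1 \<longleftrightarrow>
     \<not> (\<exists>V. openin (ambient_space H0 H1) V \<and> V \<noteq> {} \<and> intertwined_in H0 H1 V)"

end

theory Submission
  imports Defs
begin

text \<open>
  The equivalences are point-set topology of a space \<open>X\<close> partitioned into two sets \<open>A\<close> and \<open>B\<close>,
  here the ambient space and the two hypotheses. The key is the duality \<open>cl A = X - int B\<close> and
  \<open>cl B = X - int A\<close>: an open set \<open>V\<close> witnesses intertwining iff \<open>V \<subseteq> cl A \<inter> cl B\<close>, that is, iff
  \<open>V\<close> misses \<open>int A \<union> int B\<close> (lemma \<open>dense_in_both_parts_iff\<close>). So the absence of such nonempty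
  \<open>V\<close> is the density of \<open>int A \<union> int B\<close>.

  If that union is dense, its complement is closed with empty interior and contains
  \<open>A - int A\<close>, so \<open>A = int A \<union> (A - int A)\<close> is the required decomposition (lemma
  \<open>nowhere_dense_in_diff_interior\<close>). Conversely, let \<open>A = G \<union> N\<close> with \<open>G\<close> open and \<open>N\<close> nowhere
  dense. An open \<open>V\<close> that misses \<open>int A\<close> misses \<open>G\<close>, hence also \<open>cl G\<close>; if moreover
  \<open>V \<subseteq> cl A = cl G \<union> cl N\<close>, then \<open>V \<subseteq> cl N\<close>, which forces \<open>V\<close> to be empty (lemma
  \<open>dense_interiors_if_open_Un_nowhere_dense\<close>). The final trichotomy only asks whether
  \<open>G\<close> or \<open>N\<close> is empty.
\<close>

lemma dense_in_open_subtopology_iff: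
  assumes "openin X V"
  shows "dense_in (subtopology X V) (S \<inter> V) \<longleftrightarrow> V \<subseteq> X closure_of S"
proof -
  have V: "V \<subseteq> topspace X"
    using assms by (rule openin_subset)
  have "subtopology X V closure_of (S \<inter> V) = V \<inter> X closure_of (V \<inter> S)"
    by (simp add: closure_of_subtopology_open Int_commute)
  also have "\<dots> = V \<inter> X closure_of S"
    using assms by (rule openin_Int_closure_of_eq[symmetric])
  finally have "subtopology X V closure_of (S \<inter> V) = V \<inter> X closure_of S" .
  then show ?thesis
    using V unfolding dense_in_def by auto
qed

lemma closure_of_part_eq:
  assumes "A \<union> B = topspace X" and "A \<inter> B = {}"
  shows "X closure_of A = topspace X - X interior_of B"
proof -
  have "A = topspace X - B"
    using assms by blast
  then show ?thesis
    by (simp add: closure_of_complement)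
qed

lemma dense_in_both_parts_iff:
  assumes "openin X V" and "A \<union> B = topspace X" and "A \<inter> B = {}"
  shows "dense_in (subtopology X V) (A \<inter> V) \<and> dense_in (subtopology X V) (B \<inter> V) \<longleftrightarrow>
    V \<inter> (X interior_of A \<union> X interior_of B) = {}"
proof -
  have "X closure_of A = topspace X - X interior_of B"
    and "X closure_of B = topspace X - X interior_of A"
    using assms by (auto intro!: closure_of_part_eq)
  then show ?thesis
    using openin_subset[OF assms(1)]
    unfolding dense_in_open_subtopology_iff[OF assms(1)] by blast
qed

lemma dense_in_iff_meets_open:
  assumes "S \<subseteq> topspace X"
  shows "dense_in X S \<longleftrightarrow> (\<forall>V. openin X V \<and> V \<noteq> {} \<longrightarrow> V \<inter> S \<noteq> {})"
  using assms unfolding dense_in_def by (simp add: dense_intersects_open Int_commute)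

lemma nowhere_intertwined_iff_dense_interiors:
  assumes "testing_problem H0 H1"
  shows "nowhere_intertwined H0 H1 \<longleftrightarrow>
    dense_in (ambient_space H0 H1)
      (ambient_space H0 H1 interior_of H0 \<union> ambient_space H0 H1 interior_of H1)"
    (is "_ \<longleftrightarrow> dense_in ?X ?S")
proof -
  have parts: "H0 \<union> H1 = topspace ?X" "H0 \<inter> H1 = {}"
    using assms by (auto simp: testing_problem_def ambient_space_def topspace_weak_topology)
  have "?S \<subseteq> topspace ?X"
    by (simp add: interior_of_subset_topspace)
  then have "dense_in ?X ?S \<longleftrightarrow> (\<forall>V. openin ?X V \<and> V \<noteq> {} \<longrightarrow> V \<inter> ?S \<noteq> {})"
    by (rule dense_in_iff_meets_open)
  moreover have "intertwined_in H0 H1 V \<longleftrightarrow> V \<inter> ?S = {}" if "openin ?X V" for V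
    unfolding intertwined_in_def using that parts by (rule dense_in_both_parts_iff)
  ultimately show ?thesis
    unfolding nowhere_intertwined_def by meson
qed

text \<open>
  A point of \<open>A - int A\<close> lies in neither interior, as \<open>int B\<close> is disjoint from \<open>A\<close>. So this set lies
  in the closed complement of a dense open set.
\<close>

lemma nowhere_dense_in_diff_interior:
  assumes "A \<subseteq> topspace X" and "A \<inter> B = {}"
    and dense: "dense_in X (X interior_of A \<union> X interior_of B)"
  shows "nowhere_dense_in X (A - X interior_of A)"
proof -
  let ?U = "X interior_of A \<union> X interior_of B"
  have "A - X interior_of A \<subseteq> topspace X - ?U"
    using assms(1,2) interior_of_subset[of X B] by auto
  moreover have "closedin X (topspace X - ?U)"
    by (simp add: closedin_diff openin_Un)
  ultimately have "X closure_of (A - X interior_of A) \<subseteq> topspace X - ?U"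
    by (rule closure_of_minimal)
  then have "X interior_of (X closure_of (A - X interior_of A)) \<subseteq> X interior_of (topspace X - ?U)"
    by (rule interior_of_mono)
  also have "\<dots> = {}"
    using dense by (simp only: interior_of_complement dense_in_def Diff_cancel)
  finally show ?thesis
    using assms(1) by (auto simp: nowhere_dense_in_def)
qed

text \<open>
  Decomposing \<open>A\<close> also controls \<open>int B\<close>: an open set that misses \<open>int B\<close> lies in \<open>cl A\<close>. If it misses
  \<open>int A\<close> as well, only \<open>cl N\<close> is left to contain it.
\<close>

lemma dense_interiors_if_open_Un_nowhere_dense:
  assumes parts: "A \<union> B = topspace X" "A \<inter> B = {}"
    and "openin X G" and N: "nowhere_dense_in X N" and A: "A = G \<union> N"
  shows "dense_in X (X interior_of A \<union> X interior_of B)"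
proof (subst dense_in_iff_meets_open)
  show "X interior_of A \<union> X interior_of B \<subseteq> topspace X"
    by (simp add: interior_of_subset_topspace)
  show "\<forall>V. openin X V \<and> V \<noteq> {} \<longrightarrow> V \<inter> (X interior_of A \<union> X interior_of B) \<noteq> {}"
  proof (intro allI impI notI)
    fix V
    assume V: "openin X V \<and> V \<noteq> {}" and miss: "V \<inter> (X interior_of A \<union> X interior_of B) = {}"
    have "G \<subseteq> X interior_of A"
      using \<open>openin X G\<close> A by (simp add: interior_of_maximal)
    with miss have "V \<inter> G = {}"
      by blast
    then have "V \<inter> X closure_of G = {}"
      using V by (simp add: openin_Int_closure_of_eq_empty)
    moreover have "V \<subseteq> X closure_of G \<union> X closure_of N"
      using V miss openin_subset[of X V] closure_of_part_eq[OF parts]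
      by (auto simp: A)
    ultimately have "V \<subseteq> X closure_of N"
      by blast
    then have "V \<subseteq> X interior_of (X closure_of N)"
      using V by (simp add: interior_of_maximal)
    then show False
      using V N by (simp add: nowhere_dense_in_def)
  qed
qed

theorem proposition1:
  fixes H0 H1 :: "'a::polish_space measure set"
  assumes "testing_problem H0 H1"
  shows "(nowhere_intertwined H0 H1 \<longleftrightarrow>
      dense_in (ambient_space H0 H1)
        (ambient_space H0 H1 interior_of H0 \<union> ambient_space H0 H1 interior_of H1)) \<and>
    (nowhere_intertwined H0 H1 \<longleftrightarrow>
      (\<forall>H\<in>{H0, H1}. \<exists>G N. openin (ambient_space H0 H1) G \<and>
         nowhere_dense_in (ambient_space H0 H1) N \<and> H = G \<union> N)) \<and>
    (nowhere_intertwined H0 H1 \<longrightarrow>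
      (\<forall>H\<in>{H0, H1}.
        openin (ambient_space H0 H1) H \<or>
        nowhere_dense_in (ambient_space H0 H1) H \<or>
        (\<exists>G N. openin (ambient_space H0 H1) G \<and> G \<noteq> {} \<and>
           nowhere_dense_in (ambient_space H0 H1) N \<and> N \<noteq> {} \<and> H = G \<union> N)))"
proof -
  let ?X = "ambient_space H0 H1"
  let ?dense = "dense_in ?X (?X interior_of H0 \<union> ?X interior_of H1)"
  let ?decomposed = "\<forall>H\<in>{H0, H1}. \<exists>G N. openin ?X G \<and> nowhere_dense_in ?X N \<and> H = G \<union> N"
  have parts: "H0 \<union> H1 = topspace ?X" "H0 \<inter> H1 = {}"
    using assms by (auto simp: testing_problem_def ambient_space_def topspace_weak_topology)
  have iff_dense: "nowhere_intertwined H0 H1 \<longleftrightarrow> ?dense"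
    using assms by (rule nowhere_intertwined_iff_dense_interiors)
  have decomposed: ?decomposed if ?dense
  proof
    fix H
    assume "H \<in> {H0, H1}"
    then have "nowhere_dense_in ?X (H - ?X interior_of H)"
    proof (elim insertE emptyE)
      assume "H = H0"
      then show ?thesis
        using that parts nowhere_dense_in_diff_interior[of H0 ?X H1] by blast
    next
      assume "H = H1"
      then show ?thesis
        using that parts nowhere_dense_in_diff_interior[of H1 ?X H0]
        by (metis Int_commute Un_commute Un_upper2)
    qed
    moreover have "H = ?X interior_of H \<union> (H - ?X interior_of H)"
      using interior_of_subset[of ?X H] by blast
    ultimately show "\<exists>G N. openin ?X G \<and> nowhere_dense_in ?X N \<and> H = G \<union> N"
      using openin_interior_of by blast
  qed
  have ?dense if ?decomposed
  proof -
    obtain G N where "openin ?X G" "nowhere_dense_in ?X N" "H0 = G \<union> N"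
      using \<open>?decomposed\<close> by (meson insertI1)
    then show ?dense
      by (rule dense_interiors_if_open_Un_nowhere_dense[OF parts])
  qed
  with decomposed have iff_decomposed: "nowhere_intertwined H0 H1 \<longleftrightarrow> ?decomposed"
    unfolding iff_dense by (rule iffI)
  have trichotomy: "openin ?X H \<or> nowhere_dense_in ?X H \<or>
      (\<exists>G N. openin ?X G \<and> G \<noteq> {} \<and> nowhere_dense_in ?X N \<and> N \<noteq> {} \<and> H = G \<union> N)"
    if nowhere: "nowhere_intertwined H0 H1" and H: "H \<in> {H0, H1}" for H
  proof -
    obtain G N where "openin ?X G" "nowhere_dense_in ?X N" "H = G \<union> N"
      using bspec[OF iffD1[OF iff_decomposed nowhere] H] by (elim exE conjE)
    then show ?thesis
      by (cases "G = {}"; cases "N = {}") auto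
  qed
  show ?thesis
    by (intro conjI impI ballI iff_dense iff_decomposed trichotomy)
qed

end
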